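(* Let $\{\phi_i\}_{i=1}^M$ be a unit norm equiangular frame for $\mathbb{H}^N$ with $M>N$, and let $c:=|\langle\phi_i,\phi_j\rangle|^2$ for $i\neq j$. Then $\{\phi_i\phi_i^*\}_{i=1}^M$ is a Riesz sequence whose Gram matrix $[|\langle \phi_i,\phi_j\rangle|^2]_{i,j=1}^M$ has two distinct eigenvalues, both of which are non-zero: $$\lambda_1=1+(M-1)c\quad\text{and}\quad \lambda_i=1-c\ \text{ for all } i=2,3,\ldots,M.$$ Moreover, if $\{\phi_i\}_{i=1}^M$ is also a tight frame, then $c=\frac{M-N}{N(M-1)}$ and $\{\phi_i\phi_i^*\}_{i=1}^M$ is a Riesz sequence with Riesz bounds $\frac{M(N-1)}{N(M-1)}$ (lower) and $\frac{M}{N}$ (upper).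
   Context: $\mathbb{H}$ denotes $\mathbb{R}$ or $\mathbb{C}$, with the usual $\ell_2$ inner product on $\mathbb{H}^N$ (column vectors). $\{\phi_i\}_{i=1}^M\subset\mathbb{H}^N$ is a frame if there are $0<A\le B<\infty$ with $A\|\psi\|^2\le\sum_{i=1}^M|\langle\phi_i,\psi\rangle|^2\le B\|\psi\|^2$ for all $\psi\in\mathbb{H}^N$; it is tight if one can take $A=B$. It is unit norm if $\|\phi_i\|=1$ for all $i$, and equiangular if $|\langle\phi_i,\phi_j\rangle|$ takes the same value for all $i\ne j$. Outer products $\phi\phi^*$ live in $\mathbb{H}^{N\times N}$ with the Frobenius inner product $\langle S,T\rangle_F=\mathrm{Tr}(ST^* )$. A sequence $\{x_i\}_{i=1}^M$ in a finite-dimensional inner product space over $\mathbb{H}$ is a Riesz sequence with (lower and upper) Riesz bounds $0<A\le B<\infty$ if $A\sum_{i=1}^M|a_i|^2\le\|\sum_{i=1}^M a_ix_i\|^2\le B\sum_{i=1}^M|a_i|^2$ for all scalars $(a_i)_{i=1}^M\in\mathbb{H}^M$. Eigenvalues are listed with multiplicity.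
   Formalization: The dimension is assumed to satisfy N ≥ 2: for N = 1 any unit norm vectors have c = 1, so 1 − c = 0, all φ_iφ_i^* coincide and are not a Riesz sequence, and the claim always fails. *)

theory Defs
  imports "HOL-Analysis.Analysis" "Jordan_Normal_Form.Char_Poly"
begin

(* Below, "$" is indexing of the finite Cartesian products of HOL-Analysis; the vectors and
   matrices of Jordan_Normal_Form are used only for Gram matrices and their eigenvalues. *)
no_notation vec_index (infixl "$" 100)

section \<open>Real or complex scalars\<close>

text \<open>The last axiom says outright that the field is either the reals or the complex numbers; the
  other two fix conjugation on the reals and tie it to the absolute value. Inside the class
  specification \<open>of_real r\<close> has to be spelled out as \<open>r *\<^sub>R 1\<close>.\<close>

class real_or_complex = conjugatable_field + real_normed_field +
  assumes conjugate_scaleR_one: "conjugate (r *\<^sub>R 1) = r *\<^sub>R 1"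
    and mult_conjugate_scaleR: "x * conjugate x = (norm x)\<^sup>2 *\<^sub>R 1"
    and real_or_complex_cases:
      "(\<forall>x. \<exists>r. x = r *\<^sub>R 1) \<or>
       (\<exists>j. j * j = - 1 \<and> conjugate j = - j \<and> (\<forall>x. \<exists>r s. x = r *\<^sub>R 1 + s *\<^sub>R j))"

instance real :: real_or_complex
  by standard (auto simp: power2_eq_square)

instance complex :: real_or_complex
proof standard
  have "x = Re x *\<^sub>R 1 + Im x *\<^sub>R \<i>" for x
    by (simp add: complex_eq_iff)
  then have "\<forall>x. \<exists>r s. x = r *\<^sub>R 1 + s *\<^sub>R \<i>"
    by blast
  then show "(\<forall>x :: complex. \<exists>r. x = r *\<^sub>R 1) \<or>
       (\<exists>j :: complex. j * j = - 1 \<and> conjugate j = - j \<and>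
          (\<forall>x. \<exists>r s. x = r *\<^sub>R 1 + s *\<^sub>R j))"
    by (intro disjI2 exI[of _ "\<i>"]) simp
next
  show "x * conjugate x = (norm x)\<^sup>2 *\<^sub>R 1" for x :: complex
    by (simp add: complex_norm_square[symmetric] scaleR_conv_of_real del: of_real_power)
qed simp

lemma conjugate_of_real: "conjugate (of_real r) = (of_real r :: 'a::real_or_complex)"
  by (simp add: of_real_def conjugate_scaleR_one)

lemma mult_conjugate: "x * conjugate x = (of_real ((norm x)\<^sup>2) :: 'a::real_or_complex)"
  unfolding of_real_def by (rule mult_conjugate_scaleR)


section \<open>Frames\<close>

text \<open>Sequences are indexed by the natural numbers below \<open>M\<close>; values at other indices are irrelevant.
  The inner product is linear in the first argument, matching \<open>Tr (S T\<^sup>*)\<close> for matrices.\<close>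

definition hinner :: "'a::real_or_complex ^ 'n \<Rightarrow> 'a ^ 'n \<Rightarrow> 'a" where
  "hinner x y = (\<Sum>k\<in>UNIV. x $ k * conjugate (y $ k))"

lemma hinner_self: "hinner x x = of_real ((norm x)\<^sup>2)"
  by (simp add: hinner_def mult_conjugate norm_vec_def L2_set_def sum_nonneg)

definition frame_bounds :: "nat \<Rightarrow> (nat \<Rightarrow> 'a::real_or_complex ^ 'n) \<Rightarrow> real \<Rightarrow> real \<Rightarrow> bool" where
  "frame_bounds M \<phi> A B \<longleftrightarrow> 0 < A \<and> A \<le> B \<and>
     (\<forall>\<psi>. A * (norm \<psi>)\<^sup>2 \<le> (\<Sum>i<M. (norm (hinner (\<phi> i) \<psi>))\<^sup>2) \<and>
          (\<Sum>i<M. (norm (hinner (\<phi> i) \<psi>))\<^sup>2) \<le> B * (norm \<psi>)\<^sup>2)"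

definition is_frame :: "nat \<Rightarrow> (nat \<Rightarrow> 'a::real_or_complex ^ 'n) \<Rightarrow> bool" where
  "is_frame M \<phi> \<longleftrightarrow> (\<exists>A B. frame_bounds M \<phi> A B)"

definition is_tight_frame :: "nat \<Rightarrow> (nat \<Rightarrow> 'a::real_or_complex ^ 'n) \<Rightarrow> bool" where
  "is_tight_frame M \<phi> \<longleftrightarrow> (\<exists>A. frame_bounds M \<phi> A A)"

definition unit_norm :: "nat \<Rightarrow> (nat \<Rightarrow> 'a::real_or_complex ^ 'n) \<Rightarrow> bool" where
  "unit_norm M \<phi> \<longleftrightarrow> (\<forall>i<M. norm (\<phi> i) = 1)"

definition equiangular :: "nat \<Rightarrow> (nat \<Rightarrow> 'a::real_or_complex ^ 'n) \<Rightarrow> bool" where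
  "equiangular M \<phi> \<longleftrightarrow> (\<exists>a. \<forall>i<M. \<forall>j<M. i \<noteq> j \<longrightarrow> norm (hinner (\<phi> i) (\<phi> j)) = a)"


section \<open>Outer products and the Frobenius inner product\<close>

definition outer_product :: "'a::real_or_complex ^ 'n \<Rightarrow> 'a ^ 'n ^ 'n" where
  "outer_product x = (\<chi> i j. x $ i * conjugate (x $ j))"

definition adjoint_matrix :: "'a::real_or_complex ^ 'n ^ 'n \<Rightarrow> 'a ^ 'n ^ 'n" where
  "adjoint_matrix T = (\<chi> i j. conjugate (T $ j $ i))"

definition frob_inner :: "'a::real_or_complex ^ 'n ^ 'n \<Rightarrow> 'a ^ 'n ^ 'n \<Rightarrow> 'a" where
  "frob_inner S T = trace (S ** adjoint_matrix T)"

text \<open>The library norm on matrices is the one induced by the Frobenius inner product.\<close>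

lemma frob_inner_self:
  fixes S :: "'a::real_or_complex ^ 'n ^ 'n"
  shows "frob_inner S S = of_real ((norm S)\<^sup>2)"
proof -
  have "frob_inner S S = (\<Sum>i\<in>UNIV. hinner (S $ i) (S $ i))"
    by (simp add: frob_inner_def trace_def matrix_matrix_mult_def adjoint_matrix_def hinner_def)
  also have "\<dots> = of_real (\<Sum>i\<in>UNIV. (norm (S $ i))\<^sup>2)"
    by (simp add: hinner_self)
  also have "(\<Sum>i\<in>UNIV. (norm (S $ i))\<^sup>2) = (norm S)\<^sup>2"
    by (simp add: norm_vec_def[of S] L2_set_def sum_nonneg)
  finally show ?thesis .
qed

definition scale_matrix :: "'a::real_or_complex \<Rightarrow> 'a ^ 'n ^ 'n \<Rightarrow> 'a ^ 'n ^ 'n" where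
  "scale_matrix a S = (\<chi> i j. a * S $ i $ j)"


section \<open>Riesz sequences of matrices and Gram matrices\<close>

definition riesz_bounds :: "nat \<Rightarrow> (nat \<Rightarrow> 'a::real_or_complex ^ 'n ^ 'n) \<Rightarrow> real \<Rightarrow> real \<Rightarrow> bool" where
  "riesz_bounds M X A B \<longleftrightarrow> 0 < A \<and> A \<le> B \<and>
     (\<forall>a :: nat \<Rightarrow> 'a.
        A * (\<Sum>i<M. (norm (a i))\<^sup>2) \<le> (norm (\<Sum>i<M. scale_matrix (a i) (X i)))\<^sup>2 \<and>
        (norm (\<Sum>i<M. scale_matrix (a i) (X i)))\<^sup>2 \<le> B * (\<Sum>i<M. (norm (a i))\<^sup>2))"

definition is_riesz_sequence :: "nat \<Rightarrow> (nat \<Rightarrow> 'a::real_or_complex ^ 'n ^ 'n) \<Rightarrow> bool" where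
  "is_riesz_sequence M X \<longleftrightarrow> (\<exists>A B. riesz_bounds M X A B)"

definition gram_matrix :: "nat \<Rightarrow> (nat \<Rightarrow> 'a::real_or_complex ^ 'n ^ 'n) \<Rightarrow> 'a mat" where
  "gram_matrix M X = Matrix.mat M M (\<lambda>(i, j). frob_inner (X i) (X j))"

text \<open>\<open>es\<close> lists the eigenvalues of \<open>G\<close> with (algebraic) multiplicity.\<close>

definition eigenvalue_list :: "'a::real_or_complex mat \<Rightarrow> 'a list \<Rightarrow> bool" where
  "eigenvalue_list G es \<longleftrightarrow> char_poly G = (\<Prod>e\<leftarrow>es. [:- e, 1:])"

end

theory Submission
  imports Defs
begin

text \<open>
  For outer products the Frobenius inner product is \<open>\<langle>x x\<^sup>*, y y\<^sup>*\<rangle> = |\<langle>x, y\<rangle>|\<^sup>2\<close>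
  (\<open>frob_inner_outer_product\<close>), so passing from the vectors to their outer products erases the
  phases of the inner products, and equiangularity makes the Gram matrix exactly
  \<open>G = (1 - c) I + c J\<close> with \<open>J\<close> the all-ones matrix. Everything about \<open>G\<close> can then be
  computed. In the basis that consists of the all-ones vector and all but one of the coordinate
  vectors it is upper triangular, which gives its eigenvalues (\<open>char_poly_equicorrelation\<close>);
  as a quadratic form it is \<open>(1 - c) \<Sum> |a\<^sub>i|\<^sup>2 + c |\<Sum> a\<^sub>i|\<^sup>2\<close>, which lies
  between the two eigenvalues times \<open>\<Sum> |a\<^sub>i|\<^sup>2\<close> when \<open>0 \<le> c < 1\<close>
  (\<open>riesz_bounds_equicorrelated\<close>).

  What remains is \<open>0 < c < 1\<close>. Positivity is the Welch bound
  \<open>M \<le> N (1 + (M - 1) c)\<close>: the frame operator \<open>S = \<Sum> \<phi>\<^sub>i \<phi>\<^sub>i\<^sup>*\<close> has trace \<open>M\<close> and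
  squared norm \<open>M (1 + (M - 1) c)\<close>, and \<open>|Tr S|\<^sup>2 \<le> N \<parallel>S\<parallel>\<^sup>2\<close>; with \<open>c = 0\<close> it would
  contradict \<open>M > N\<close>. For \<open>c < 1\<close>, the form at the difference of two coordinate vectors is
  \<open>\<parallel>\<phi>\<^sub>i \<phi>\<^sub>i\<^sup>* - \<phi>\<^sub>j \<phi>\<^sub>j\<^sup>*\<parallel>\<^sup>2 = 2 (1 - c)\<close>. Hence \<open>c \<le> 1\<close>, and \<open>c = 1\<close> would make all the
  outer products equal; a vector orthogonal to \<open>\<phi>\<^sub>0\<close>, which exists because \<open>N \<ge> 2\<close>,
  would be orthogonal to every \<open>\<phi>\<^sub>i\<close>, against the lower frame bound.

  If the frame is tight with bound \<open>A\<close>, summing the frame identity over the coordinate vectors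
  gives \<open>M = A N\<close>, and evaluating it at one of the \<open>\<phi>\<^sub>j\<close> gives \<open>1 + (M - 1) c = A\<close>.
  These two equations determine \<open>c\<close> and turn the two eigenvalues into the stated Riesz bounds.
\<close>

section \<open>Inner products of outer products\<close>

lemma conjugate_one: "conjugate (1 :: 'a::real_or_complex) = 1"
  using conjugate_of_real[of 1, where 'a = 'a] by simp

lemma conjugate_sum:
  "conjugate (\<Sum>i\<in>I. f i :: 'a::real_or_complex) = (\<Sum>i\<in>I. conjugate (f i))"
  using sum_conjugate[of I f] by (cases "finite I") auto

lemma frob_inner_entries:
  "frob_inner S T = (\<Sum>k\<in>UNIV. \<Sum>l\<in>UNIV. S $ k $ l * conjugate (T $ k $ l))"
  by (simp add: frob_inner_def trace_def matrix_matrix_mult_def adjoint_matrix_def)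

lemma frob_inner_outer_product:
  "frob_inner (outer_product x) (outer_product y) = of_real ((norm (hinner x y))\<^sup>2)"
proof -
  have "frob_inner (outer_product x) (outer_product y) = hinner x y * conjugate (hinner x y)"
    by (simp add: frob_inner_entries outer_product_def hinner_def conjugate_sum sum_product
        conjugate_dist_mul mult_ac)
  then show ?thesis
    by (simp only: mult_conjugate)
qed

lemma frob_inner_combination:
  "frob_inner (\<Sum>i<M. scale_matrix (a i) (X i)) (\<Sum>j<M. scale_matrix (a j) (X j))
     = (\<Sum>i<M. \<Sum>j<M. a i * conjugate (a j) * frob_inner (X i) (X j))"
proof -
  have "frob_inner (\<Sum>i<M. scale_matrix (a i) (X i)) (\<Sum>j<M. scale_matrix (a j) (X j))
     = (\<Sum>k\<in>UNIV. \<Sum>l\<in>UNIV. \<Sum>i<M. \<Sum>j<M.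
          a i * conjugate (a j) * (X i $ k $ l * conjugate (X j $ k $ l)))"
    by (simp add: frob_inner_entries scale_matrix_def conjugate_sum conjugate_dist_mul
        sum_product mult_ac)
  also have "\<dots> = (\<Sum>k\<in>UNIV. \<Sum>i<M. \<Sum>l\<in>UNIV. \<Sum>j<M.
          a i * conjugate (a j) * (X i $ k $ l * conjugate (X j $ k $ l)))"
    by (rule sum.cong[OF refl], rule sum.swap)
  also have "\<dots> = (\<Sum>i<M. \<Sum>k\<in>UNIV. \<Sum>l\<in>UNIV. \<Sum>j<M.
          a i * conjugate (a j) * (X i $ k $ l * conjugate (X j $ k $ l)))"
    by (rule sum.swap)
  also have "\<dots> = (\<Sum>i<M. \<Sum>k\<in>UNIV. \<Sum>j<M. \<Sum>l\<in>UNIV.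
          a i * conjugate (a j) * (X i $ k $ l * conjugate (X j $ k $ l)))"
    by (rule sum.cong[OF refl], rule sum.cong[OF refl], rule sum.swap)
  also have "\<dots> = (\<Sum>i<M. \<Sum>j<M. \<Sum>k\<in>UNIV. \<Sum>l\<in>UNIV.
          a i * conjugate (a j) * (X i $ k $ l * conjugate (X j $ k $ l)))"
    by (rule sum.cong[OF refl], rule sum.swap)
  finally show ?thesis
    by (simp add: frob_inner_entries sum_distrib_left)
qed

section \<open>Sequences with Gram matrix \<open>(1 - c) I + c J\<close>\<close>

definition equicorrelated ::
  "nat \<Rightarrow> (nat \<Rightarrow> 'a::real_or_complex ^ 'n ^ 'n) \<Rightarrow> real \<Rightarrow> bool" where
  "equicorrelated M X c \<longleftrightarrow>
     (\<forall>i<M. \<forall>j<M. frob_inner (X i) (X j) = of_real (if i = j then 1 else c))"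

lemma norm_combination_equicorrelated:
  fixes X :: "nat \<Rightarrow> 'a::real_or_complex ^ 'n ^ 'n"
  assumes "equicorrelated M X c"
  shows "(norm (\<Sum>i<M. scale_matrix (a i) (X i)))\<^sup>2
           = (1 - c) * (\<Sum>i<M. (norm (a i))\<^sup>2) + c * (norm (\<Sum>i<M. a i))\<^sup>2"
proof -
  have split: "a i * conjugate (a j) * frob_inner (X i) (X j)
      = (if i = j then of_real (1 - c) * (a i * conjugate (a j)) else 0)
        + of_real c * (a i * conjugate (a j))"
    if "i < M" "j < M" for i j
    using assms that by (auto simp: equicorrelated_def algebra_simps)
  have "of_real ((norm (\<Sum>i<M. scale_matrix (a i) (X i)))\<^sup>2)
      = (\<Sum>i<M. \<Sum>j<M. a i * conjugate (a j) * frob_inner (X i) (X j))"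
    by (simp only: frob_inner_self[symmetric] frob_inner_combination)
  also have "\<dots> = (\<Sum>i<M. \<Sum>j<M.
        (if i = j then of_real (1 - c) * (a i * conjugate (a j)) else 0)
        + of_real c * (a i * conjugate (a j)))"
    by (intro sum.cong refl split) auto
  also have "\<dots> = of_real (1 - c) * (\<Sum>i<M. a i * conjugate (a i))
      + of_real c * ((\<Sum>i<M. a i) * conjugate (\<Sum>i<M. a i))"
    by (simp add: sum.distrib conjugate_sum sum_product sum_distrib_left[symmetric])
  also have "\<dots> = of_real ((1 - c) * (\<Sum>i<M. (norm (a i))\<^sup>2) + c * (norm (\<Sum>i<M. a i))\<^sup>2)"
    unfolding mult_conjugate by simp
  finally show ?thesis
    by (simp only: of_real_eq_iff)
qed

text \<open>The lower bound drops the term \<open>c |\<Sum> a\<^sub>i|\<^sup>2\<close>; the upper one estimates it by the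
  Cauchy--Schwarz inequality. The two constants are the eigenvalues of the Gram matrix.\<close>

lemma riesz_bounds_equicorrelated:
  fixes X :: "nat \<Rightarrow> 'a::real_or_complex ^ 'n ^ 'n"
  assumes X: "equicorrelated M X c" and "0 \<le> c" "c < 1"
  shows "riesz_bounds M X (1 - c) (1 - c + real M * c)"
  unfolding riesz_bounds_def
proof (intro conjI allI)
  fix a :: "nat \<Rightarrow> 'a"
  have "(norm (\<Sum>i<M. a i))\<^sup>2 \<le> (\<Sum>i<M. norm (a i))\<^sup>2"
    by (intro power_mono norm_sum) simp
  also have "\<dots> \<le> real M * (\<Sum>i<M. (norm (a i))\<^sup>2)"
    using sum_squared_le_sum_of_squares[of "\<lambda>i. norm (a i)" "{..<M}"] by (simp add: mult.commute)
  finally have "c * (norm (\<Sum>i<M. a i))\<^sup>2 \<le> c * (real M * (\<Sum>i<M. (norm (a i))\<^sup>2))"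
    using \<open>0 \<le> c\<close> by (intro mult_left_mono)
  then show "(norm (\<Sum>i<M. scale_matrix (a i) (X i)))\<^sup>2
      \<le> (1 - c + real M * c) * (\<Sum>i<M. (norm (a i))\<^sup>2)"
    unfolding norm_combination_equicorrelated[OF X] by (simp add: algebra_simps)
  show "(1 - c) * (\<Sum>i<M. (norm (a i))\<^sup>2) \<le> (norm (\<Sum>i<M. scale_matrix (a i) (X i)))\<^sup>2"
    unfolding norm_combination_equicorrelated[OF X] using \<open>0 \<le> c\<close> by simp
qed (use assms in auto)

lemma norm_diff_equicorrelated:
  fixes X :: "nat \<Rightarrow> 'a::real_or_complex ^ 'n ^ 'n"
  assumes X: "equicorrelated M X c" and ij: "i < M" "j < M" "i \<noteq> j"
  shows "(norm (X i - X j))\<^sup>2 = 2 * (1 - c)"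
proof -
  define a :: "nat \<Rightarrow> 'a" where "a k = (if k = i then 1 else if k = j then - 1 else 0)" for k
  have supp: "(\<Sum>k<M. f k) = f i + f j" if "\<And>k. k \<noteq> i \<Longrightarrow> k \<noteq> j \<Longrightarrow> f k = 0"
    for f :: "nat \<Rightarrow> 'b::comm_monoid_add"
  proof -
    have "(\<Sum>k<M. f k) = (\<Sum>k\<in>{i, j}. f k)"
      using ij that by (intro sum.mono_neutral_right) auto
    then show ?thesis using ij by simp
  qed
  have "(\<Sum>k<M. scale_matrix (a k) (X k)) = X i - X j"
    using ij by (subst supp) (auto simp: a_def scale_matrix_def Finite_Cartesian_Product.vec_eq_iff)
  moreover have "(\<Sum>k<M. (norm (a k))\<^sup>2) = 2"
    using ij by (subst supp) (auto simp: a_def)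
  moreover have "(\<Sum>k<M. a k) = 0"
    using ij by (subst supp) (auto simp: a_def)
  ultimately show ?thesis
    using norm_combination_equicorrelated[OF X, of a] by simp
qed

section \<open>The spectrum of \<open>d I + c J\<close>\<close>

text \<open>In the basis \<open>(1, \<dots>, 1), e\<^sub>1, \<dots>, e\<^bsub>M-1\<^esub>\<close> the matrix \<open>d I + c J\<close> is upper triangular:
  it sends the all-ones vector to \<open>d + M c\<close> times itself, and \<open>e\<^sub>j\<close> to \<open>d e\<^sub>j\<close> plus
  \<open>c\<close> times the all-ones vector.\<close>

lemma char_poly_equicorrelation:
  fixes c d :: "'a::comm_ring_1"
  assumes "M > 0"
  shows "char_poly (Matrix.mat M M (\<lambda>(i, j). if i = j then d + c else c))
           = (\<Prod>e\<leftarrow>(d + of_nat M * c) # replicate (M - 1) d. [:- e, 1:])"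
proof -
  let ?G = "Matrix.mat M M (\<lambda>(i, j). if i = j then d + c else c)"
  \<comment> \<open>The columns of \<open>P\<close> are the new basis, \<open>Q\<close> is its inverse, and \<open>T\<close> is the matrix
    in that basis.\<close>
  define P :: "'a mat" where
    "P = Matrix.mat M M (\<lambda>(i, j). if i = j \<or> j = 0 then 1 else 0)"
  define Q :: "'a mat" where
    "Q = Matrix.mat M M (\<lambda>(i, j). if i = j then 1 else if j = 0 then - 1 else 0)"
  define T :: "'a mat" where
    "T = Matrix.mat M M (\<lambda>(i, j). if i = 0 then (if j = 0 then d + of_nat M * c else c)
                                   else if i = j then d else 0)"
  note dims = P_def Q_def T_def
  have two: "(\<Sum>k\<in>{0..<M}. f k) = f 0 + (if i = 0 then 0 else f i)"
    if "i < M" "\<And>k. k \<noteq> 0 \<Longrightarrow> k \<noteq> i \<Longrightarrow> f k = 0" for f :: "nat \<Rightarrow> 'a" and i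
  proof -
    have "(\<Sum>k\<in>{0..<M}. f k) = (\<Sum>k\<in>{0, i}. f k)"
      using that assms by (intro sum.mono_neutral_right) auto
    then show ?thesis by auto
  qed
  have PQ: "P * Q = 1\<^sub>m M"
  proof (rule eq_matI)
    fix i j assume "i < dim_row (1\<^sub>m M :: 'a mat)" "j < dim_col (1\<^sub>m M :: 'a mat)"
    then have ij: "i < M" "j < M" by auto
    show "(P * Q) $$ (i, j) = 1\<^sub>m M $$ (i, j)"
      using ij assms by (simp add: dims scalar_prod_def two[OF ij(1)])
  qed (simp_all add: dims)
  have QP: "Q * P = 1\<^sub>m M"
  proof (rule eq_matI)
    fix i j assume "i < dim_row (1\<^sub>m M :: 'a mat)" "j < dim_col (1\<^sub>m M :: 'a mat)"
    then have ij: "i < M" "j < M" by auto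
    show "(Q * P) $$ (i, j) = 1\<^sub>m M $$ (i, j)"
      using ij assms by (simp add: dims scalar_prod_def two[OF ij(1)])
  qed (simp_all add: dims)
  have GP: "?G * P = P * T"
  proof (rule eq_matI)
    fix i j assume "i < dim_row (P * T)" "j < dim_col (P * T)"
    then have ij: "i < M" "j < M" by (auto simp: dims)
    have row: "(\<Sum>k\<in>{0..<M}. if i = k then d + c else c) = d + of_nat M * c"
    proof -
      have "(\<Sum>k\<in>{0..<M}. if i = k then d + c else c)
          = (\<Sum>k\<in>{0..<M}. (if i = k then d else 0) + c)"
        by (intro sum.cong) auto
      then show ?thesis using ij by (simp add: sum.distrib)
    qed
    have "(?G * P) $$ (i, j)
        = (\<Sum>k\<in>{0..<M}. (if i = k then d + c else c) * (if k = j \<or> j = 0 then 1 else 0))"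
      using ij by (simp add: dims scalar_prod_def)
    also have "\<dots> = (if j = 0 then d + of_nat M * c else if i = j then d + c else c)"
      using row ij by (simp add: if_distrib[of "\<lambda>x. _ * x"] cong: if_cong)
    also have "\<dots> = (P * T) $$ (i, j)"
      using ij assms by (simp add: dims scalar_prod_def two[OF ij(1)])
    finally show "(?G * P) $$ (i, j) = (P * T) $$ (i, j)" .
  qed (simp_all add: dims)
  have carrier: "?G \<in> carrier_mat M M" "P \<in> carrier_mat M M" "Q \<in> carrier_mat M M"
      "T \<in> carrier_mat M M"
    by (auto simp: dims)
  have "P * T * Q = ?G * (P * Q)"
    unfolding GP[symmetric] using carrier by (rule_tac assoc_mult_mat)
  then have "?G = P * T * Q"
    using carrier by (simp only: PQ right_mult_one_mat)
  then have "similar_mat ?G T"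
    using carrier PQ QP by (intro similar_matI[of _ _ P Q M]) auto
  then have "char_poly ?G = char_poly T"
    by (rule char_poly_similar)
  also have "\<dots> = (\<Prod>e\<leftarrow>diag_mat T. [:- e, 1:])"
    using carrier(4) by (rule char_poly_upper_triangular) (auto simp: upper_triangular_def dims)
  also have "diag_mat T = (d + of_nat M * c) # replicate (M - 1) d"
    using assms by (auto simp: diag_mat_def dims list_eq_iff_nth_eq nth_Cons split: nat.splits)
  finally show ?thesis .
qed

lemma eigenvalue_eq_of_char_poly:
  fixes G :: "'a::field mat"
  assumes "G \<in> carrier_mat n n" and "char_poly G = (\<Prod>e\<leftarrow>es. [:- e, 1:])"
  shows "Collect (eigenvalue G) = set es"
proof -
  have "poly (\<Prod>e\<leftarrow>es. [:- e, 1:]) x = 0 \<longleftrightarrow> x \<in> set es" for x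
    by (induction es) auto
  then show ?thesis
    using eigenvalue_root_char_poly[OF assms(1)] assms(2) by auto
qed

section \<open>The size of the common angle\<close>

lemma norm_trace_le:
  fixes S :: "'a::real_or_complex ^ 'n ^ 'n"
  shows "(norm (trace S))\<^sup>2 \<le> real CARD('n) * (norm S)\<^sup>2"
proof -
  have "(norm (trace S))\<^sup>2 \<le> (\<Sum>k\<in>UNIV. norm (S $ k $ k))\<^sup>2"
    unfolding trace_def by (intro power_mono norm_sum) simp
  also have "\<dots> \<le> real CARD('n) * (\<Sum>k\<in>UNIV. (norm (S $ k $ k))\<^sup>2)"
    using sum_squared_le_sum_of_squares[of "\<lambda>k. norm (S $ k $ k)" "UNIV :: 'n set"]
    by (simp add: mult.commute)
  also have "(\<Sum>k\<in>UNIV. (norm (S $ k $ k))\<^sup>2) \<le> (\<Sum>k\<in>UNIV. (norm (S $ k))\<^sup>2)"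
    by (intro sum_mono power_mono Finite_Cartesian_Product.norm_nth_le) simp
  also have "\<dots> = (norm S)\<^sup>2"
    by (simp add: norm_vec_def[of S] L2_set_def sum_nonneg)
  finally show ?thesis by simp
qed

text \<open>This is the Welch bound: the frame operator \<open>\<Sum> \<phi>\<^sub>i \<phi>\<^sub>i\<^sup>*\<close> has trace \<open>M\<close>, and its squared
  norm is the value of the Gram form at \<open>(1, \<dots>, 1)\<close>.\<close>

lemma welch_bound_equicorrelated:
  fixes \<phi> :: "nat \<Rightarrow> 'a::real_or_complex ^ 'n"
  assumes X: "equicorrelated M (\<lambda>i. outer_product (\<phi> i)) c" and unit: "unit_norm M \<phi>"
    and "M > 0"
  shows "real M \<le> real CARD('n) * (1 + (real M - 1) * c)"
proof -
  define S where "S = (\<Sum>i<M. scale_matrix 1 (outer_product (\<phi> i)))"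
  have "trace S = (\<Sum>i<M. hinner (\<phi> i) (\<phi> i))"
    unfolding S_def trace_def hinner_def
    by (simp add: scale_matrix_def outer_product_def, rule sum.swap)
  also have "\<dots> = of_nat M"
    using unit by (simp add: hinner_self unit_norm_def)
  finally have "(norm (trace S))\<^sup>2 = (real M)\<^sup>2"
    by simp
  moreover have "(norm S)\<^sup>2 = real M * (1 + (real M - 1) * c)"
    unfolding S_def norm_combination_equicorrelated[OF X]
    by (simp add: power2_eq_square algebra_simps)
  ultimately have "real M * real M \<le> real M * (real CARD('n) * (1 + (real M - 1) * c))"
    using norm_trace_le[of S] by (simp add: power2_eq_square mult_ac)
  then show ?thesis
    using \<open>M > 0\<close> by simp
qed

lemma exists_orthogonal:
  fixes x :: "'a::real_or_complex ^ 'n"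
  assumes "CARD('n) \<ge> 2" "x \<noteq> 0"
  shows "\<exists>y. y \<noteq> 0 \<and> hinner x y = 0"
proof -
  obtain k where k: "x $ k \<noteq> 0"
    using \<open>x \<noteq> 0\<close> unfolding Finite_Cartesian_Product.vec_eq_iff by auto
  obtain l where l: "l \<noteq> k"
    using assms(1) by (metis (full_types) UNIV_I card_2_iff' card_le_Suc0_iff_eq finite
        not_less_eq_eq numeral_2_eq_2)
  \<comment> \<open>Rotate the coordinates \<open>k\<close> and \<open>l\<close> by a right angle and conjugate them, so that the two terms
    \<open>\<plusminus> x\<^sub>k x\<^sub>l\<close> of the inner product cancel.\<close>
  define y :: "'a ^ 'n" where
    "y = (\<chi> m. if m = k then conjugate (x $ l) else if m = l then - conjugate (x $ k) else 0)"
  have "hinner x y = (\<Sum>m\<in>{k, l}. x $ m * conjugate (y $ m))"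
    unfolding hinner_def by (intro sum.mono_neutral_right) (auto simp: y_def)
  also have "\<dots> = 0"
    using l by (simp add: y_def conjugate_neg mult.commute)
  moreover have "y $ l \<noteq> 0"
    using k l by (simp add: y_def)
  then have "y \<noteq> 0" by auto
  ultimately show ?thesis by auto
qed

text \<open>The distances between the outer products are \<open>\<surd>(2 (1 - c))\<close>. If these vanish, all frame
  vectors have the same orthogonal complement, which is non-trivial in dimension at least two,
  and a non-zero vector in it violates the lower frame bound.\<close>

lemma equicorrelated_frame_less_one:
  fixes \<phi> :: "nat \<Rightarrow> 'a::real_or_complex ^ 'n"
  assumes X: "equicorrelated M (\<lambda>i. outer_product (\<phi> i)) c" and unit: "unit_norm M \<phi>"
    and frame: "is_frame M \<phi>" and N: "CARD('n) \<ge> 2" and M: "M > 1"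
  shows "c < 1"
proof -
  have diff: "(norm (outer_product (\<phi> i) - outer_product (\<phi> 0)))\<^sup>2 = 2 * (1 - c)"
    if "i < M" "i \<noteq> 0" for i
    using norm_diff_equicorrelated[OF X] that M by simp
  have "0 \<le> 2 * (1 - c)"
    unfolding diff[OF M one_neq_zero, symmetric] by (rule zero_le_power2)
  moreover have "c \<noteq> 1"
  proof
    assume "c = 1"
    then have same: "outer_product (\<phi> i) = outer_product (\<phi> 0)" if "i < M" for i
      using diff[of i] that by (cases "i = 0") auto
    have "norm (\<phi> 0) = 1"
      using unit M by (simp add: unit_norm_def)
    then have "\<phi> 0 \<noteq> 0"
      by auto
    then obtain \<psi> where \<psi>: "\<psi> \<noteq> 0" "hinner (\<phi> 0) \<psi> = 0"
      using exists_orthogonal[OF N] by blast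
    have "hinner (\<phi> i) \<psi> = 0" if "i < M" for i
      using frob_inner_outer_product[of "\<phi> i" \<psi>] frob_inner_outer_product[of "\<phi> 0" \<psi>]
        same[OF that] \<psi>(2) by simp
    then have "(\<Sum>i<M. (norm (hinner (\<phi> i) \<psi>))\<^sup>2) = 0"
      by simp
    moreover obtain A where "A > 0" "A * (norm \<psi>)\<^sup>2 \<le> (\<Sum>i<M. (norm (hinner (\<phi> i) \<psi>))\<^sup>2)"
      using frame unfolding is_frame_def frame_bounds_def by blast
    ultimately have "A * (norm \<psi>)\<^sup>2 \<le> 0" "A > 0"
      by simp_all
    moreover have "A * (norm \<psi>)\<^sup>2 > 0"
      using \<open>A > 0\<close> \<psi>(1) by simp
    ultimately show False by simp
  qed
  ultimately show ?thesis by simp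
qed

text \<open>Summing the frame identity over the coordinate vectors computes the trace of the frame operator
  in two ways.\<close>

lemma tight_frame_bound:
  fixes \<phi> :: "nat \<Rightarrow> 'a::real_or_complex ^ 'n"
  assumes "frame_bounds M \<phi> A A" and unit: "unit_norm M \<phi>"
  shows "A * real CARD('n) = real M"
proof -
  have tight: "(\<Sum>i<M. (norm (hinner (\<phi> i) \<psi>))\<^sup>2) = A * (norm \<psi>)\<^sup>2" for \<psi>
    using assms(1) unfolding frame_bounds_def by (meson order_antisym)
  have coord: "hinner x (axis k 1) = x $ k" for x :: "'a ^ 'n" and k
  proof -
    have "hinner x (axis k 1) = (\<Sum>m\<in>{k}. x $ m * conjugate (axis k 1 $ m))"
      unfolding hinner_def by (intro sum.mono_neutral_right) (auto simp: axis_def)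
    then show ?thesis by (simp add: conjugate_one)
  qed
  have norm_axis_one: "(norm (axis k 1 :: 'a ^ 'n))\<^sup>2 = 1" for k
  proof -
    have "of_real ((norm (axis k 1 :: 'a ^ 'n))\<^sup>2) = (1 :: 'a)"
      unfolding hinner_self[symmetric] coord by (simp add: axis_def)
    then show ?thesis
      by (simp only: of_real_eq_1_iff)
  qed
  have "A * real CARD('n) = (\<Sum>k\<in>(UNIV :: 'n set). A * (norm (axis k 1 :: 'a ^ 'n))\<^sup>2)"
    by (simp add: norm_axis_one)
  also have "\<dots> = (\<Sum>k\<in>UNIV. \<Sum>i<M. (norm (\<phi> i $ k))\<^sup>2)"
    by (simp only: tight[symmetric] coord)
  also have "\<dots> = (\<Sum>i<M. \<Sum>k\<in>UNIV. (norm (\<phi> i $ k))\<^sup>2)"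
    by (rule sum.swap)
  also have "\<dots> = (\<Sum>i<M. (norm (\<phi> i))\<^sup>2)"
    by (simp add: norm_vec_def L2_set_def sum_nonneg)
  also have "\<dots> = real M"
    using unit by (simp add: unit_norm_def)
  finally show ?thesis .
qed

section \<open>Equiangular frames\<close>

theorem theorem4p6:
  fixes \<phi> :: "nat \<Rightarrow> 'a::real_or_complex ^ 'n::finite" and M :: nat and c :: real
  assumes "CARD('n) \<ge> 2"
    and "M > CARD('n)"
    and "is_frame M \<phi>"
    and "unit_norm M \<phi>"
    and "equiangular M \<phi>"
    and "\<forall>i<M. \<forall>j<M. i \<noteq> j \<longrightarrow> c = (norm (hinner (\<phi> i) (\<phi> j)))\<^sup>2"
  shows "let N = CARD('n);
             X = (\<lambda>i. outer_product (\<phi> i));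
             G = gram_matrix M X;
             ev1 = 1 + (real M - 1) * c;
             ev2 = 1 - c
         in is_riesz_sequence M X
          \<and> G = Matrix.mat M M (\<lambda>(i, j). of_real ((norm (hinner (\<phi> i) (\<phi> j)))\<^sup>2))
          \<and> eigenvalue_list G (of_real ev1 # replicate (M - 1) (of_real ev2))
          \<and> Collect (eigenvalue G) = {of_real ev1, of_real ev2}
          \<and> ev1 \<noteq> ev2 \<and> ev1 \<noteq> 0 \<and> ev2 \<noteq> 0
          \<and> (is_tight_frame M \<phi> \<longrightarrow>
               c = (real M - real N) / (real N * (real M - 1))
             \<and> riesz_bounds M X (real M * (real N - 1) / (real N * (real M - 1)))
                                (real M / real N))"
proof -
  define X where "X = (\<lambda>i. outer_product (\<phi> i))"
  define G where "G = gram_matrix M X"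
  define ev1 where "ev1 = 1 + (real M - 1) * c"
  define ev2 where "ev2 = 1 - c"
  have M: "M > 1"
    using assms(1,2) by simp
  have Cr: "real CARD('n) > 0" "real M > 1"
    using M by auto
  have sq: "(norm (hinner (\<phi> i) (\<phi> j)))\<^sup>2 = (if i = j then 1 else c)"
    if "i < M" "j < M" for i j
    using assms(4,6) that by (auto simp: hinner_self unit_norm_def)
  have X: "equicorrelated M X c"
    unfolding equicorrelated_def X_def frob_inner_outer_product using sq by auto
  have "(norm (hinner (\<phi> 0) (\<phi> 1)))\<^sup>2 = c"
    using sq[of 0 1] M by simp
  then have c0: "c \<ge> 0"
    by (metis zero_le_power2)
  have "c \<noteq> 0"
    using welch_bound_equicorrelated[OF X[unfolded X_def] assms(4)] M assms(2) by auto
  with c0 have cpos: "c > 0" by simp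
  have c1: "c < 1"
    using equicorrelated_frame_less_one[OF X[unfolded X_def] assms(4,3,1) M] .
  have ev1_alt: "ev1 = 1 - c + real M * c"
    by (simp add: ev1_def algebra_simps)
  have riesz: "riesz_bounds M X ev2 ev1"
    using riesz_bounds_equicorrelated[OF X c0 c1] by (simp add: ev1_alt ev2_def)
  have G: "G = Matrix.mat M M (\<lambda>(i, j). of_real ((norm (hinner (\<phi> i) (\<phi> j)))\<^sup>2))"
    by (simp add: G_def gram_matrix_def X_def frob_inner_outer_product)
  have "G = Matrix.mat M M (\<lambda>(i, j). if i = j then of_real ev2 + of_real c else of_real c)"
    unfolding G by (rule eq_matI) (auto simp: sq ev2_def simp del: of_real_power)
  then have cp: "char_poly G = (\<Prod>e\<leftarrow>of_real ev1 # replicate (M - 1) (of_real ev2). [:- e, 1:])"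
    using char_poly_equicorrelation[of M "of_real ev2 :: 'a" "of_real c"] M
    by (simp add: ev1_alt ev2_def)
  have "Collect (eigenvalue G) = set (of_real ev1 # replicate (M - 1) (of_real ev2))"
    by (rule eigenvalue_eq_of_char_poly[OF _ cp, of M]) (simp add: G)
  then have spectrum: "Collect (eigenvalue G) = {of_real ev1, of_real ev2}"
    using M by simp
  have evs: "ev1 \<noteq> ev2" "ev1 \<noteq> 0" "ev2 \<noteq> 0"
    using cpos c1 Cr by (auto simp: ev1_alt ev2_def add_pos_nonneg less_imp_neq[symmetric])
  have tight: "c = (real M - real CARD('n)) / (real CARD('n) * (real M - 1))
      \<and> riesz_bounds M X (real M * (real CARD('n) - 1) / (real CARD('n) * (real M - 1)))
                         (real M / real CARD('n))"
    if tight_frame: "is_tight_frame M \<phi>"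
  proof -
    obtain A where A: "frame_bounds M \<phi> A A"
      using tight_frame unfolding is_tight_frame_def by blast
    \<comment> \<open>The frame identity at \<open>\<phi> 0\<close> shows that the tight frame bound is the larger eigenvalue.\<close>
    have "ev1 = (\<Sum>i<M. if i = 0 then 1 else c)"
      using M by (cases M) (simp_all add: ev1_def sum.lessThan_Suc_shift del: sum.lessThan_Suc)
    also have "\<dots> = (\<Sum>i<M. (norm (hinner (\<phi> i) (\<phi> 0)))\<^sup>2)"
      using M by (intro sum.cong) (auto simp: sq)
    also have "\<dots> = A * (norm (\<phi> 0))\<^sup>2"
      using A unfolding frame_bounds_def by (meson order_antisym)
    also have "\<dots> = A"
      using assms(4) M by (simp add: unit_norm_def)
    finally have "ev1 * real CARD('n) = real M"
      using tight_frame_bound[OF A assms(4)] by simp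
    then have upper: "ev1 = real M / real CARD('n)"
      using Cr by (simp add: field_simps)
    have "(real M - 1) * c = real M / real CARD('n) - 1"
      using upper by (simp add: ev1_def)
    then have c: "c = (real M / real CARD('n) - 1) / (real M - 1)"
      using Cr by (simp add: field_simps)
    also have "\<dots> = (real M - real CARD('n)) / (real CARD('n) * (real M - 1))"
      using Cr by (simp add: divide_simps)
    finally have c_eq: "c = (real M - real CARD('n)) / (real CARD('n) * (real M - 1))" .
    have "ev2 = real M * (real CARD('n) - 1) / (real CARD('n) * (real M - 1))"
      unfolding ev2_def c_eq using Cr by (simp add: divide_simps) (simp add: algebra_simps)
    with upper riesz c_eq show ?thesis by simp
  qed
  show ?thesis
    unfolding Let_def X_def[symmetric] G_def[symmetric] ev1_def[symmetric] ev2_def[symmetric]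
      eigenvalue_list_def is_riesz_sequence_def
    using riesz G cp spectrum evs tight by blast
qed

end
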